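(* Let $G$ be a graph with matching number $t$. Then \[mis(G)\leq 3^t,\] with equality if and only if $G\cong tK_3\cup rK_1$ for some natural number $r\geq 0$.
   Context: All graphs are finite and simple. An independent set of a graph is a set of pairwise non-adjacent vertices; a maximal independent set (MIS) is an independent set not properly contained in any other independent set. $mis(G)$ denotes the number of maximal independent sets of $G$. The matching number of $G$ is the maximum number of edges in a matching (set of pairwise disjoint edges) of $G$. $K_n$ denotes the complete graph on $n$ vertices; for graphs $G,H$, $G\cup H$ is their disjoint union and $kG$ is the disjoint union of $k$ copies of $G$. *)

theory Defs
  imports
    "Graph_Theory.Pair_Digraph"
    "Graph_Theory.Digraph_Isomorphism"
    "Graph_Theory.Kuratowski"
    "HOL-Library.Disjoint_Sets"
begin

text \<open>
  A finite simple graph is a \<^locale>\<open>pair_graph\<close>: a finite vertex set with a symmetric, irreflexive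
  adjacency relation. Each undirected edge \<open>uv\<close> thus appears as the two arcs \<open>(u, v)\<close> and
  \<open>(v, u)\<close>; the set \<open>edges\<close> identifies them, so that matchings are counted in undirected edges.
\<close>

definition edges :: "'a pair_pre_digraph \<Rightarrow> 'a set set" where
  "edges G = {{u, v} | u v. (u, v) \<in> parcs G}"

definition matching :: "'a pair_pre_digraph \<Rightarrow> 'a set set \<Rightarrow> bool" where
  "matching G M \<longleftrightarrow> M \<subseteq> edges G \<and> disjoint M"

definition matching_number :: "'a pair_pre_digraph \<Rightarrow> nat" where
  "matching_number G = Max {card M | M. matching G M}"

definition independent_set :: "'a pair_pre_digraph \<Rightarrow> 'a set \<Rightarrow> bool" where
  "independent_set G S \<longleftrightarrow> S \<subseteq> pverts G \<and> (\<forall>u\<in>S. \<forall>v\<in>S. (u, v) \<notin> parcs G)"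

definition maximal_independent_set :: "'a pair_pre_digraph \<Rightarrow> 'a set \<Rightarrow> bool" where
  "maximal_independent_set G S \<longleftrightarrow>
     independent_set G S \<and> \<not> (\<exists>T. independent_set G T \<and> S \<subset> T)"

definition mis :: "'a pair_pre_digraph \<Rightarrow> nat" where
  "mis G = card {S. maximal_independent_set G S}"

definition complete_graph :: "nat \<Rightarrow> nat pair_pre_digraph" where
  "complete_graph n =
     \<lparr> pverts = {..<n}, parcs = {(u, v). u < n \<and> v < n \<and> u \<noteq> v} \<rparr>"

definition disjoint_union ::
    "'a pair_pre_digraph \<Rightarrow> 'b pair_pre_digraph \<Rightarrow> ('a + 'b) pair_pre_digraph" where
  "disjoint_union G H =
     \<lparr> pverts = pverts G <+> pverts H,
       parcs = {(Inl u, Inl v) | u v. (u, v) \<in> parcs G} \<union> {(Inr u, Inr v) | u v. (u, v) \<in> parcs H} \<rparr>"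

definition copies :: "nat \<Rightarrow> 'a pair_pre_digraph \<Rightarrow> (nat \<times> 'a) pair_pre_digraph" where
  "copies k G =
     \<lparr> pverts = {..<k} \<times> pverts G,
       parcs = {((i, u), (i, v)) | i u v. i < k \<and> (u, v) \<in> parcs G} \<rparr>"

lemma complete_digraph_complete_graph: "K\<^bsub>n\<^esub> (with_proj (complete_graph n))"
  unfolding complete_digraph_pair_def by (auto simp: complete_graph_def)

lemma pair_graph_complete_graph: "pair_graph (complete_graph n)"
  by (rule pair_graphI_complete[OF complete_digraph_complete_graph])

lemma pair_graph_iff:
  "pair_graph G \<longleftrightarrow>
     finite (pverts G) \<and> parcs G \<subseteq> pverts G \<times> pverts G \<and> sym (parcs G) \<and> irrefl (parcs G)"
proof
  assume "pair_graph G"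
  then interpret pair_graph G .
  have "finite (pverts G)" by (rule pair_finite_verts)
  moreover have "parcs G \<subseteq> pverts G \<times> pverts G" by (auto dest: in_arcsD1 in_arcsD2)
  moreover have "sym (parcs G)" by (rule symI) (rule arcs_symmetric)
  moreover have "irrefl (parcs G)" unfolding irrefl_def using no_loops' by blast
  ultimately show "finite (pverts G) \<and> parcs G \<subseteq> pverts G \<times> pverts G \<and> sym (parcs G) \<and> irrefl (parcs G)"
    by blast
next
  assume G: "finite (pverts G) \<and> parcs G \<subseteq> pverts G \<times> pverts G \<and> sym (parcs G) \<and> irrefl (parcs G)"
  then have "finite (parcs G)" by (meson finite_SigmaI finite_subset)
  show "pair_graph G"
  proof
    show "fst e \<in> pverts G" if "e \<in> parcs G" for e using G that by auto
    show "snd e \<in> pverts G" if "e \<in> parcs G" for e using G that by auto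
    show "finite (pverts G)" using G by blast
    show "finite (parcs G)" by fact
    show "fst e \<noteq> snd e" if "e \<in> parcs G" for e
      using G that unfolding irrefl_def by (metis prod.collapse)
    show "symmetric (with_proj G)" using G by (simp add: symmetric_def)
  qed
qed

lemma pair_graph_disjoint_union:
  "pair_graph G \<Longrightarrow> pair_graph H \<Longrightarrow> pair_graph (disjoint_union G H)"
  unfolding pair_graph_iff by (auto simp: disjoint_union_def irrefl_def sym_def)

lemma pair_graph_copies: "pair_graph G \<Longrightarrow> pair_graph (copies k G)"
  unfolding pair_graph_iff by (auto simp: copies_def irrefl_def sym_def)

text \<open>
  Isomorphism of \<^locale>\<open>pair_graph\<close>s in the sense of \<^const>\<open>digraph_iso\<close> is the usual notion of an
  adjacency-preserving and adjacency-reflecting bijection between the vertex sets.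
\<close>

lemma digraph_iso_pair_iff:
  assumes "pair_wf_digraph G" "pair_wf_digraph H"
  shows "digraph_iso (with_proj G) (with_proj H) \<longleftrightarrow>
    (\<exists>f. bij_betw f (pverts G) (pverts H) \<and>
      (\<forall>u\<in>pverts G. \<forall>v\<in>pverts G. (u, v) \<in> parcs G \<longleftrightarrow> (f u, f v) \<in> parcs H))" (is "?L \<longleftrightarrow> ?R")
proof
  assume ?L
  then obtain h where h: "pre_digraph.digraph_isomorphism (with_proj G) h"
    and H: "with_proj H = app_iso h (with_proj G)"
    unfolding digraph_iso_def by blast
  let ?f = "iso_verts h"
  from H have V: "pverts H = ?f ` pverts G" and A: "parcs H = iso_arcs h ` parcs G"
    and tl: "iso_tail h = fst" and hd: "iso_head h = snd"
    by (simp_all add: with_proj_def app_iso_def)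
  have inj: "inj_on ?f (pverts G)"
    using h by (simp add: pre_digraph.digraph_isomorphism_def)
  have "iso_arcs h (u, v) = (?f u, ?f v)" if "(u, v) \<in> parcs G" for u v
    using h that tl hd by (force simp: pre_digraph.digraph_isomorphism_def with_proj_def prod_eq_iff)
  then have A': "parcs H = (\<lambda>(u, v). (?f u, ?f v)) ` parcs G"
    unfolding A by (intro image_cong) auto
  have G: "parcs G \<subseteq> pverts G \<times> pverts G"
    using assms(1) by (auto dest: pair_wf_digraph.in_arcsD1 pair_wf_digraph.in_arcsD2)
  have "(u, v) \<in> parcs G \<longleftrightarrow> (?f u, ?f v) \<in> parcs H"
    if uv: "u \<in> pverts G" "v \<in> pverts G" for u v
  proof
    show "(?f u, ?f v) \<in> parcs H" if "(u, v) \<in> parcs G"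
      unfolding A' using that by (rule rev_image_eqI) simp
  next
    assume "(?f u, ?f v) \<in> parcs H"
    then obtain x y where xy: "(x, y) \<in> parcs G" "?f u = ?f x" "?f v = ?f y"
      unfolding A' by auto
    with G have "x \<in> pverts G" "y \<in> pverts G" by auto
    with xy uv inj show "(u, v) \<in> parcs G" by (metis inj_onD)
  qed
  with inj V show ?R by (intro exI[of _ ?f]) (simp add: bij_betw_def)
next
  assume ?R
  then obtain f where f: "inj_on f (pverts G)" "f ` pverts G = pverts H"
    and e: "\<forall>u\<in>pverts G. \<forall>v\<in>pverts G. (u, v) \<in> parcs G \<longleftrightarrow> (f u, f v) \<in> parcs H"
    by (auto simp: bij_betw_def)
  have G: "parcs G \<subseteq> pverts G \<times> pverts G"
    using assms(1) by (auto dest: pair_wf_digraph.in_arcsD1 pair_wf_digraph.in_arcsD2)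
  have H: "parcs H \<subseteq> f ` pverts G \<times> f ` pverts G"
    using assms(2) f(2) by (auto dest: pair_wf_digraph.in_arcsD1 pair_wf_digraph.in_arcsD2)
  define h where "h = \<lparr> iso_verts = f, iso_arcs = map_prod f f, iso_head = snd, iso_tail = fst \<rparr>"
  have inj: "inj_on (map_prod f f) (parcs G)"
    using map_prod_inj_on[OF f(1) f(1)] G by (rule inj_on_subset)
  have "pre_digraph.digraph_isomorphism (with_proj G) h"
    using f(1) inj assms(1)
    by (auto simp: pre_digraph.digraph_isomorphism_def h_def with_proj_def
        wf_digraph_wp_iff[symmetric])
  moreover have "map_prod f f ` parcs G = parcs H"
  proof
    show "map_prod f f ` parcs G \<subseteq> parcs H" using G e by auto
    show "parcs H \<subseteq> map_prod f f ` parcs G"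
    proof
      fix x assume "x \<in> parcs H"
      with H obtain u v where uv: "x = (f u, f v)" "u \<in> pverts G" "v \<in> pverts G" by blast
      with e \<open>x \<in> parcs H\<close> have "(u, v) \<in> parcs G" by simp
      with uv show "x \<in> map_prod f f ` parcs G" by force
    qed
  qed
  then have "with_proj H = app_iso h (with_proj G)"
    using f(2) by (simp add: app_iso_def h_def with_proj_def)
  ultimately show ?L unfolding digraph_iso_def by blast
qed

end

theory Submission
  imports Defs
begin

text \<open>
  Fix a maximum matching \<open>M\<close>. The unmatched vertices are independent, so a maximal independent set
  is determined by its trace on the matched vertices, and it meets every edge of \<open>M\<close> in the empty
  set or in one of the two endpoints: this leaves \<open>3 ^ t\<close> possibilities. If all of them occur, then
  no edge joins two distinct members of \<open>M\<close>. The trace that is empty on \<open>e \<in> M\<close> forces both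
  endpoints of \<open>e\<close> to have an unmatched neighbour; as there is no augmenting path, this is one common
  vertex and it is the only unmatched neighbour of either endpoint. Prescribing an endpoint of another
  edge \<open>e'\<close> shows that these apices are distinct, so the graph consists of disjoint triangles and
  isolated vertices.
\<close>

section \<open>Maximality as domination, and finiteness of the counted families\<close>

lemma maximal_independent_set_iff:
  assumes "pair_graph G"
  shows "maximal_independent_set G S \<longleftrightarrow>
    independent_set G S \<and> (\<forall>v\<in>pverts G - S. \<exists>u\<in>S. (u, v) \<in> parcs G)"
proof (intro iffI conjI ballI)
  interpret pair_graph G by fact
  assume S: "maximal_independent_set G S"
  then show ind: "independent_set G S" by (simp add: maximal_independent_set_def)
  fix v assume v: "v \<in> pverts G - S"
  \<comment> \<open>Since there are no loops, what prevents adding \<open>v\<close> is an arc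
    between \<open>v\<close> and a member of \<open>S\<close>, in one of its two
    orientations.\<close>
  with S have "\<not> independent_set G (insert v S)"
    unfolding maximal_independent_set_def by blast
  with ind v show "\<exists>u\<in>S. (u, v) \<in> parcs G"
    unfolding independent_set_def using arcs_symmetric no_loops' by blast
next
  assume S: "independent_set G S \<and> (\<forall>v\<in>pverts G - S. \<exists>u\<in>S. (u, v) \<in> parcs G)"
  have False if T: "independent_set G T" "S \<subset> T" for T
  proof -
    from T(2) obtain v where v: "v \<in> T" "v \<notin> S" by blast
    with T(1) have "v \<in> pverts G - S" by (auto simp: independent_set_def)
    with S obtain u where "u \<in> S" "(u, v) \<in> parcs G" by blast
    with T v show False by (auto simp: independent_set_def)
  qed
  with S show "maximal_independent_set G S" by (auto simp: maximal_independent_set_def)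
qed

context pair_graph
begin

lemma finite_edges: "finite (edges G)"
proof -
  have "edges G = (\<lambda>(u, v). {u, v}) ` parcs G" by (auto simp: edges_def)
  then show ?thesis by simp
qed

text \<open>\<open>Max\<close> in \<open>matching_number\<close> is a true maximum only on a finite
  nonempty set. Finiteness comes from \<open>edges G\<close> having finitely many subsets; the empty
  matching later gives nonemptiness.\<close>

lemma finite_matching_cards: "finite {card M | M. matching G M}"
proof -
  have "{card M | M. matching G M} \<subseteq> card ` Pow (edges G)" by (auto simp: matching_def)
  then show ?thesis by (rule finite_subset) (simp add: finite_edges)
qed

lemma card_matching_le: "matching G M \<Longrightarrow> card M \<le> matching_number G"
  unfolding matching_number_def by (rule Max_ge[OF finite_matching_cards]) blast

lemma obtain_maximum_matching:
  obtains M where "matching G M" "card M = matching_number G"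
proof -
  have "matching G {}" by (simp add: matching_def)
  then have "matching_number G \<in> {card M | M. matching G M}"
    unfolding matching_number_def by (intro Max_in finite_matching_cards) blast
  with that show thesis by auto
qed

lemma mis_finite: "finite {S. maximal_independent_set G S}"
  by (rule finite_subset[of _ "Pow (pverts G)"])
    (auto simp: maximal_independent_set_def independent_set_def)

end

section \<open>Unmatched vertices relative to a fixed maximum matching\<close>

locale maximum_matching = pair_graph G for G :: "'a pair_pre_digraph" +
  fixes M :: "'a set set"
  assumes matching_M: "matching G M" and card_M: "card M = matching_number G"
begin

abbreviation unmatched :: "'a set" where
  "unmatched \<equiv> pverts G - \<Union>M"

lemma finite_M: "finite M"
  using matching_M finite_edges by (auto simp: matching_def intro: finite_subset)

lemma M_edge:
  assumes "e \<in> M"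
  obtains a b where "e = {a, b}" "(a, b) \<in> parcs G" "(b, a) \<in> parcs G" "a \<noteq> b"
    "a \<in> pverts G" "b \<in> pverts G"
proof -
  from assms matching_M obtain a b where "e = {a, b}" "(a, b) \<in> parcs G"
    by (auto simp: matching_def edges_def)
  moreover from this(2) have "a \<noteq> b" "(b, a) \<in> parcs G" "a \<in> pverts G" "b \<in> pverts G"
    using no_loops' arcs_symmetric in_arcsD1 in_arcsD2 by blast+
  ultimately show thesis using that by blast
qed

lemma M_disjoint: "e \<in> M \<Longrightarrow> e' \<in> M \<Longrightarrow> x \<in> e \<Longrightarrow> x \<in> e' \<Longrightarrow> e = e'"
  using matching_M unfolding matching_def disjoint_def by blast

lemma M_subset_verts: "e \<in> M \<Longrightarrow> x \<in> e \<Longrightarrow> x \<in> pverts G"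
  by (erule M_edge) auto

text \<open>An arc between unmatched vertices would give an edge that enlarges
  \<open>M\<close>.\<close>

lemma unmatched_independent:
  assumes "u \<in> unmatched" "v \<in> unmatched"
  shows "(u, v) \<notin> parcs G"
proof
  assume uv: "(u, v) \<in> parcs G"
  have "matching G (insert {u, v} M)"
    using assms uv matching_M by (auto simp: matching_def edges_def pairwise_insert disjnt_iff)
  then have "card (insert {u, v} M) \<le> card M"
    using card_matching_le card_M by simp
  moreover have "{u, v} \<notin> M" using assms by auto
  ultimately show False using finite_M by simp
qed

text \<open>Otherwise \<open>u, a, b, v\<close> would be an augmenting path.\<close>

lemma unmatched_neighbours_eq:
  assumes e: "{a, b} \<in> M" "a \<noteq> b" and uv: "u \<in> unmatched" "v \<in> unmatched"
    and arcs: "(u, a) \<in> parcs G" "(v, b) \<in> parcs G"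
  shows "u = v"
proof (rule ccontr)
  assume "u \<noteq> v"
  let ?N = "insert {u, a} (insert {v, b} (M - {{a, b}}))"
  have rest: "x \<notin> f" if "f \<in> M - {{a, b}}" "x \<in> {u, v, a, b}" for f x
    using that uv M_disjoint[OF _ e(1), of f x] by simp blast
  have ne: "a \<noteq> u" "b \<noteq> u" "a \<noteq> v" "b \<noteq> v" using e(1) uv by blast+
  have "disjnt {u, a} f" "disjnt {v, b} f" if "f \<in> M - {{a, b}}" for f
    using rest[OF that] by (simp_all add: disjnt_insert1)
  moreover have "disjnt {u, a} {v, b}" using ne \<open>u \<noteq> v\<close> \<open>a \<noteq> b\<close> by (simp add: disjnt_insert1)
  moreover have "disjoint (M - {{a, b}})"
    using matching_M by (auto simp: matching_def intro: pairwise_subset)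
  ultimately have "disjoint ?N"
    unfolding pairwise_insert by (metis disjnt_sym insert_iff)
  moreover have "?N \<subseteq> edges G"
    using arcs matching_M unfolding matching_def edges_def by blast
  ultimately have "card ?N \<le> card M"
    using card_matching_le card_M unfolding matching_def by simp
  \<comment> \<open>The swap removes one edge and adds two distinct ones not in \<open>M\<close>, so
    \<open>?N\<close> has one edge more than \<open>M\<close>.\<close>
  moreover have "{u, a} \<noteq> {v, b}" using \<open>u \<noteq> v\<close> ne by (simp add: doubleton_eq_iff)
  moreover have "{u, a} \<notin> M" "{v, b} \<notin> M" using uv by blast+
  moreover have "Suc (card (M - {{a, b}})) = card M"
    using e(1) finite_M by (metis card_Suc_Diff1)
  ultimately show False using finite_M by simp
qed

section \<open>The upper bound by counting traces on the matching\<close>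

definition trace :: "'a set \<Rightarrow> 'a set \<Rightarrow> 'a set" where
  "trace S = (\<lambda>e\<in>M. S \<inter> e)"

text \<open>One empty choice and two singletons per edge are the three options behind
  \<open>3 ^ t\<close>. Extensional functions on \<open>M\<close> make \<open>card_PiE\<close>
  applicable; hence the restricted lambda in \<open>trace\<close>.\<close>

definition traces :: "('a set \<Rightarrow> 'a set) set" where
  "traces = (\<Pi>\<^sub>E e\<in>M. insert {} ((\<lambda>x. {x}) ` e))"

lemma card_traces: "card traces = 3 ^ card M"
proof -
  have "card (insert {} ((\<lambda>x. {x}) ` e)) = 3" if "e \<in> M" for e
    using that by (rule M_edge) simp
  then show ?thesis unfolding traces_def by (simp add: card_PiE finite_M)
qed

lemma finite_traces: "finite traces"
  by (rule card_ge_0_finite) (simp add: card_traces)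

lemma trace_in_traces:
  assumes "independent_set G S"
  shows "trace S \<in> traces"
  unfolding trace_def traces_def restrict_PiE_iff
proof
  fix e assume "e \<in> M"
  then show "S \<inter> e \<in> insert {} ((\<lambda>x. {x}) ` e)"
  proof (rule M_edge)
    fix a b assume "e = {a, b}" "(a, b) \<in> parcs G"
    with assms show ?thesis by (auto simp: independent_set_def)
  qed
qed

text \<open>By maximality an unmatched vertex outside \<open>S\<close> has a neighbour in
  \<open>S\<close>, which is matched because unmatched vertices are pairwise non-adjacent. Hence the
  matched part of \<open>S\<close> determines the rest, which makes \<open>trace\<close>
  injective.\<close>

lemma maximal_independent_set_unmatched_iff:
  assumes S: "maximal_independent_set G S" and u: "u \<in> unmatched"
  shows "u \<in> S \<longleftrightarrow> (\<forall>v\<in>S \<inter> \<Union>M. (v, u) \<notin> parcs G)"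
proof -
  have *: "independent_set G S" "\<forall>v\<in>pverts G - S. \<exists>u\<in>S. (u, v) \<in> parcs G"
    using S maximal_independent_set_iff pair_graph_axioms by blast+
  show ?thesis
  proof
    show "\<forall>v\<in>S \<inter> \<Union>M. (v, u) \<notin> parcs G" if "u \<in> S"
      using that * by (auto simp: independent_set_def)
  next
    assume no: "\<forall>v\<in>S \<inter> \<Union>M. (v, u) \<notin> parcs G"
    show "u \<in> S"
    proof (rule ccontr)
      assume "u \<notin> S"
      with u * obtain v where v: "v \<in> S" "(v, u) \<in> parcs G" by blast
      with no have "v \<in> unmatched" using in_arcsD1 by blast
      with u v unmatched_independent show False by blast
    qed
  qed
qed

lemma inj_on_trace: "inj_on trace {S. maximal_independent_set G S}"
proof (rule inj_onI, unfold mem_Collect_eq)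
  fix S T assume S: "maximal_independent_set G S" and T: "maximal_independent_set G T"
    and "trace S = trace T"
  then have "S \<inter> e = T \<inter> e" if "e \<in> M" for e
    using that unfolding trace_def by (metis restrict_apply')
  then have eq: "S \<inter> \<Union>M = T \<inter> \<Union>M" by blast
  then have un: "u \<in> S \<longleftrightarrow> u \<in> T" if "u \<in> unmatched" for u
    using maximal_independent_set_unmatched_iff[OF S that]
      maximal_independent_set_unmatched_iff[OF T that] by simp
  have "S \<subseteq> pverts G" "T \<subseteq> pverts G"
    using S T by (simp_all add: maximal_independent_set_def independent_set_def)
  then show "S = T" using eq un by (intro set_eqI) (metis DiffI IntE IntI subsetD)
qed

lemma trace_image_subset: "trace ` {S. maximal_independent_set G S} \<subseteq> traces"
  using trace_in_traces by (auto simp: maximal_independent_set_def)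

lemma mis_le: "mis G \<le> 3 ^ card M"
  unfolding mis_def card_traces[symmetric]
  by (rule card_inj_on_le[OF inj_on_trace trace_image_subset finite_traces])

end

section \<open>Adjacency around the matching in the extremal case\<close>

locale extremal_matching = maximum_matching +
  assumes mis_eq: "mis G = 3 ^ card M"
begin

text \<open>The injection \<open>trace\<close> goes into a finite set of the same size, so it is
  onto and every choice function is realised. Extremality enters the structural argument only
  here.\<close>

lemma obtain_maximal_independent_set:
  assumes "c \<in> traces"
  obtains S where "independent_set G S" "\<forall>v\<in>pverts G - S. \<exists>u\<in>S. (u, v) \<in> parcs G"
    "\<forall>e\<in>M. S \<inter> e = c e"
proof -
  have "card (trace ` {S. maximal_independent_set G S}) = card traces"
    using mis_eq by (simp add: card_image[OF inj_on_trace] card_traces mis_def)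
  then have "trace ` {S. maximal_independent_set G S} = traces"
    by (rule card_subset_eq[OF finite_traces trace_image_subset])
  with assms have "c \<in> trace ` {S. maximal_independent_set G S}" by simp
  then obtain S where S: "maximal_independent_set G S" "trace S = c" by auto
  show thesis
  proof (rule that)
    show "\<forall>e\<in>M. S \<inter> e = c e" using S(2) by (auto simp: trace_def)
  qed (use S(1) maximal_independent_set_iff[OF pair_graph_axioms] in blast)+
qed

text \<open>Realise the empty choice on every edge: \<open>S\<close> avoids all matched vertices yet
  dominates \<open>x\<close>, so the dominating vertex is unmatched.\<close>

lemma ex_unmatched_neighbour:
  assumes "e \<in> M" "x \<in> e"
  shows "\<exists>u\<in>unmatched. (u, x) \<in> parcs G"
proof -
  have "(\<lambda>e\<in>M. {}) \<in> traces" by (simp add: traces_def)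
  then obtain S where S: "independent_set G S"
      "\<forall>v\<in>pverts G - S. \<exists>u\<in>S. (u, v) \<in> parcs G"
      "\<forall>e\<in>M. S \<inter> e = (\<lambda>e\<in>M. {}) e"
    by (rule obtain_maximal_independent_set)
  then have "S \<inter> \<Union>M = {}" by auto
  with S(1) have "S \<subseteq> unmatched" by (auto simp: independent_set_def)
  moreover have "x \<in> pverts G - S"
    using assms \<open>S \<inter> \<Union>M = {}\<close> M_subset_verts by blast
  ultimately show ?thesis using S(2) by blast
qed

text \<open>Choosing \<open>x\<close> on \<open>e\<close> and \<open>y\<close> on \<open>e'\<close>
  is realised, so some independent set contains both.\<close>

lemma matched_edges_separated:
  assumes e: "e \<in> M" "e' \<in> M" "e \<noteq> e'" and x: "x \<in> e" and y: "y \<in> e'"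
  shows "(x, y) \<notin> parcs G"
proof -
  have "(\<lambda>f\<in>M. if f = e then {x} else if f = e' then {y} else {}) \<in> traces"
    using x y by (auto simp: traces_def)
  then obtain S where S: "independent_set G S"
      "\<forall>v\<in>pverts G - S. \<exists>u\<in>S. (u, v) \<in> parcs G"
      "\<forall>f\<in>M. S \<inter> f = (\<lambda>f\<in>M. if f = e then {x} else if f = e' then {y} else {}) f"
    by (rule obtain_maximal_independent_set)
  from S(3)[rule_format, OF e(1)] S(3)[rule_format, OF e(2)] e have "x \<in> S" "y \<in> S" by auto
  with S(1) show ?thesis by (simp add: independent_set_def)
qed

text \<open>Realise the choice of \<open>y\<close> and no other matched vertex. The set dominates
  \<open>x\<close>, not through \<open>y\<close> because distinct matching edges are separated, so
  through an unmatched vertex, which independence keeps non-adjacent to \<open>y\<close>.\<close>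

lemma ex_private_neighbour:
  assumes e: "e \<in> M" "e' \<in> M" "e \<noteq> e'" and x: "x \<in> e" and y: "y \<in> e'"
  shows "\<exists>u\<in>unmatched. (u, x) \<in> parcs G \<and> (u, y) \<notin> parcs G"
proof -
  have "(\<lambda>f\<in>M. if f = e' then {y} else {}) \<in> traces"
    using y by (auto simp: traces_def)
  then obtain S where S: "independent_set G S"
      "\<forall>v\<in>pverts G - S. \<exists>u\<in>S. (u, v) \<in> parcs G"
      "\<forall>f\<in>M. S \<inter> f = (\<lambda>f\<in>M. if f = e' then {y} else {}) f"
    by (rule obtain_maximal_independent_set)
  from S(3)[rule_format, OF e(1)] S(3)[rule_format, OF e(2)] e x have xS: "x \<notin> S" and yS: "y \<in> S" by auto
  with S(2) M_subset_verts e x obtain u where u: "u \<in> S" "(u, x) \<in> parcs G" by blast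
  have "u \<notin> f" if "f \<in> M" for f
  proof
    assume "u \<in> f"
    with S(3)[rule_format, OF that] that u have "u = y" by (auto split: if_splits)
    with u e x y matched_edges_separated[of e' e y x] show False by auto
  qed
  with u have "u \<in> unmatched" using in_arcsD1 by blast
  moreover have "(u, y) \<notin> parcs G" using S(1) u yS by (auto simp: independent_set_def)
  ultimately show ?thesis using u by blast
qed

section \<open>Apices and the resulting triangles\<close>

definition apex :: "'a set \<Rightarrow> 'a" where
  "apex e = (SOME u. u \<in> unmatched \<and> (\<exists>x\<in>e. (u, x) \<in> parcs G))"

text \<open>Both endpoints have an unmatched neighbour, and any such neighbour of one equals any
  such neighbour of the other, as there is no augmenting path. So the \<open>SOME\<close> in
  \<open>apex\<close> picks from a singleton.\<close>

lemma apex_unmatched: "e \<in> M \<Longrightarrow> apex e \<in> unmatched"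
  and arc_apex_iff: "e \<in> M \<Longrightarrow> x \<in> e \<Longrightarrow> u \<in> unmatched \<Longrightarrow> (u, x) \<in> parcs G \<longleftrightarrow> u = apex e"
proof -
  have *: "apex e \<in> unmatched \<and>
      (\<forall>x\<in>e. \<forall>u\<in>unmatched. (u, x) \<in> parcs G \<longleftrightarrow> u = apex e)" if e: "e \<in> M" for e
    using e
  proof (rule M_edge)
    fix a b assume ab: "e = {a, b}" "a \<noteq> b"
    obtain u where u: "u \<in> unmatched" "(u, a) \<in> parcs G"
      using ex_unmatched_neighbour[OF e, of a] ab(1) by auto
    obtain v where v: "v \<in> unmatched" "(v, b) \<in> parcs G"
      using ex_unmatched_neighbour[OF e, of b] ab(1) by auto
    have uniq: "w = w'" if "w \<in> unmatched" "w' \<in> unmatched" "(w, a) \<in> parcs G" "(w', b) \<in> parcs G"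
      for w w'
      by (rule unmatched_neighbours_eq[of a b]) (use e ab that in simp_all)
    have "u = v" by (rule uniq) fact+
    \<comment> \<open>For \<open>x = a\<close> compare \<open>w\<close> with \<open>v\<close> across
      the edge, for \<open>x = b\<close> compare \<open>u\<close> with \<open>w\<close>.\<close>
    have nb: "(w, x) \<in> parcs G \<longleftrightarrow> w = u" if x: "x \<in> e" and w: "w \<in> unmatched" for w x
      using x uniq[OF w v(1) _ v(2)] uniq[OF u(1) w u(2)] u(2) v(2) \<open>u = v\<close> unfolding ab(1) by auto
    then have "w \<in> unmatched \<and> (\<exists>x\<in>e. (w, x) \<in> parcs G) \<longleftrightarrow> w = u" for w
      using u(1) ab(1) by auto
    then have "apex e = u" unfolding apex_def by simp
    with u nb show ?thesis by blast
  qed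
  from * show "e \<in> M \<Longrightarrow> apex e \<in> unmatched"
    and "e \<in> M \<Longrightarrow> x \<in> e \<Longrightarrow> u \<in> unmatched \<Longrightarrow> (u, x) \<in> parcs G \<longleftrightarrow> u = apex e" by blast+
qed

text \<open>With a common apex, endpoints of the two edges would share their only unmatched
  neighbour, contrary to \<open>ex_private_neighbour\<close>.\<close>

lemma inj_on_apex: "inj_on apex M"
proof (rule inj_onI, rule ccontr)
  fix e e' assume e: "e \<in> M" "e' \<in> M" and eq: "apex e = apex e'" and ne: "e \<noteq> e'"
  obtain x y where "x \<in> e" "y \<in> e'" using e by (metis M_edge insertI1)
  with ex_private_neighbour[OF e ne] arc_apex_iff e eq show False by metis
qed

definition triangle :: "'a set \<Rightarrow> 'a set" where
  "triangle e = insert (apex e) e"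

lemma card_triangle:
  assumes "e \<in> M"
  shows "card (triangle e) = 3"
proof -
  have "apex e \<notin> e" using assms apex_unmatched by blast
  then show ?thesis using assms by (auto simp: triangle_def elim!: M_edge)
qed

lemma triangle_subset_verts: "e \<in> M \<Longrightarrow> triangle e \<subseteq> pverts G"
  using apex_unmatched M_subset_verts by (auto simp: triangle_def)

text \<open>Apices are unmatched, so a shared vertex is an apex in both triangles or an endpoint in
  both; injectivity of \<open>apex\<close> settles the first case, disjointness of \<open>M\<close>
  the second.\<close>

lemma triangle_disjoint:
  assumes "e \<in> M" "e' \<in> M" "x \<in> triangle e" "x \<in> triangle e'"
  shows "e = e'"
proof -
  have "apex e \<notin> e'" "apex e' \<notin> e" using assms apex_unmatched by blast+
  then consider "x = apex e" "x = apex e'" | "x \<in> e" "x \<in> e'"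
    using assms by (auto simp: triangle_def)
  then show ?thesis
    using assms inj_onD[OF inj_on_apex] M_disjoint by cases auto
qed

text \<open>Forwards, sort arcs by how many ends are matched: none is impossible, one leads to the
  apex, two must lie on a single matching edge. In particular, vertices outside all triangles are
  isolated.\<close>

lemma arc_iff_triangle: "(x, y) \<in> parcs G \<longleftrightarrow> x \<noteq> y \<and> (\<exists>e\<in>M. x \<in> triangle e \<and> y \<in> triangle e)"
proof
  assume xy: "(x, y) \<in> parcs G"
  then have yx: "(y, x) \<in> parcs G" and V: "x \<in> pverts G" "y \<in> pverts G" "x \<noteq> y"
    using arcs_symmetric in_arcsD1 in_arcsD2 no_loops' by blast+
  consider "x \<in> unmatched" "y \<in> unmatched" | e where "e \<in> M" "x \<in> e" "y \<in> unmatched"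
    | e where "e \<in> M" "y \<in> e" "x \<in> unmatched" | e e' where "e \<in> M" "x \<in> e" "e' \<in> M" "y \<in> e'"
    using V by blast
  then show "x \<noteq> y \<and> (\<exists>e\<in>M. x \<in> triangle e \<and> y \<in> triangle e)"
  proof cases
    case 1
    then show ?thesis using xy unmatched_independent by blast
  next
    case (2 e)
    then show ?thesis using V yx arc_apex_iff by (auto simp: triangle_def)
  next
    case (3 e)
    then show ?thesis using V xy arc_apex_iff by (auto simp: triangle_def)
  next
    case (4 e e')
    then show ?thesis
      using V xy matched_edges_separated[of e e' x y] by (auto simp: triangle_def)
  qed
next
  assume "x \<noteq> y \<and> (\<exists>e\<in>M. x \<in> triangle e \<and> y \<in> triangle e)"
  then obtain e where e: "e \<in> M" "x \<noteq> y" "x \<in> triangle e" "y \<in> triangle e" by blast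
  from e(1) show "(x, y) \<in> parcs G"
  proof (rule M_edge)
    fix a b assume ab: "e = {a, b}" "(a, b) \<in> parcs G" "(b, a) \<in> parcs G"
    have "(apex e, z) \<in> parcs G \<and> (z, apex e) \<in> parcs G" if "z \<in> e" for z
      using arc_apex_iff[OF e(1) that] apex_unmatched[OF e(1)] arcs_symmetric by blast
    with ab e show ?thesis by (auto simp: triangle_def)
  qed
qed

end

section \<open>Disjoint unions of triangles and isolated vertices\<close>

lemma pverts_triangles:
  "pverts (disjoint_union (copies t (complete_graph 3)) (copies r (complete_graph 1))) =
    ({..<t} \<times> {..<3}) <+> ({..<r} \<times> {..<1})"
  by (simp add: disjoint_union_def copies_def complete_graph_def)

lemma parcs_triangles:
  "parcs (disjoint_union (copies t (complete_graph 3)) (copies r (complete_graph 1))) =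
    {(Inl (i, k), Inl (i, l)) | i k l. i < t \<and> k < 3 \<and> l < 3 \<and> k \<noteq> l}"
  by (fastforce simp: disjoint_union_def copies_def complete_graph_def)

lemma pair_wf_digraph_triangles:
  "pair_wf_digraph (disjoint_union (copies t (complete_graph 3)) (copies r (complete_graph 1)))"
proof -
  interpret pair_graph "disjoint_union (copies t (complete_graph 3)) (copies r (complete_graph 1))"
    by (intro pair_graph_disjoint_union pair_graph_copies pair_graph_complete_graph)
  show ?thesis by (rule pair_wf_digraph_axioms)
qed

text \<open>Bookkeeping for any finite family of disjoint triples that carries all arcs;
  \<open>r\<close> is the number of vertices in no triple.\<close>

lemma digraph_iso_triangles:
  fixes I :: "'b set"
  assumes G: "pair_graph G" and I: "finite I" and card: "\<And>e. e \<in> I \<Longrightarrow> card (T e) = 3"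
    and sub: "\<And>e. e \<in> I \<Longrightarrow> T e \<subseteq> pverts G"
    and disj: "\<And>e e' x. e \<in> I \<Longrightarrow> e' \<in> I \<Longrightarrow> x \<in> T e \<Longrightarrow> x \<in> T e' \<Longrightarrow> e = e'"
    and arc: "\<And>x y. (x, y) \<in> parcs G \<longleftrightarrow> x \<noteq> y \<and> (\<exists>e\<in>I. x \<in> T e \<and> y \<in> T e)"
  shows "\<exists>r. digraph_iso (with_proj G) (with_proj
    (disjoint_union (copies (card I) (complete_graph 3)) (copies r (complete_graph 1))))"
proof -
  interpret pair_graph G by fact
  define W where "W = pverts G - (\<Union>e\<in>I. T e)"
  have "finite W" by (simp add: W_def)
  then obtain z where z: "bij_betw z {..<card W} W"
    using ex_bij_betw_nat_finite by (metis atLeast0LessThan)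
  obtain h where h: "bij_betw h {..<card I} I"
    using I ex_bij_betw_nat_finite by (metis atLeast0LessThan)
  have "\<exists>w. bij_betw w {..<3::nat} (T e)" if "e \<in> I" for e
    using ex_bij_betw_nat_finite[of "T e"] card[OF that]
    by (metis atLeast0LessThan card.infinite zero_neq_numeral)
  then obtain w where w: "bij_betw (w e) {..<3::nat} (T e)" if "e \<in> I" for e by metis
  let ?H = "disjoint_union (copies (card I) (complete_graph 3)) (copies (card W) (complete_graph 1))"
  \<comment> \<open>\<open>h\<close> enumerates the triples, \<open>w e\<close> the vertices of
    each, \<open>z\<close> the isolated vertices. The map leaves the model, where vertices can be
    analysed by cases; the second coordinate in a copy of \<open>complete_graph 1\<close> is always
    0 and is dropped.\<close>
  define \<phi> where "\<phi> = case_sum (\<lambda>(i, k). w (h i) k) (\<lambda>(j, k::nat). z j)"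
  have \<phi>: "\<phi> (Inl (i, k)) = w (h i) k" "\<phi> (Inr (j, l)) = z j" for i j k l
    by (simp_all add: \<phi>_def)
  have hI: "h i \<in> I" if "i < card I" for i using h that by (auto simp: bij_betw_def)
  have h_eq: "h i = h i' \<longleftrightarrow> i = i'" if "i < card I" "i' < card I" for i i'
    using h that by (auto simp: bij_betw_def inj_on_def)
  have wT: "w (h i) k \<in> T (h i)" if "i < card I" "k < 3" for i k
    using w[OF hI] that by (auto simp: bij_betw_def)
  have zW: "z j \<in> W" if "j < card W" for j using z that by (auto simp: bij_betw_def)
  have zT: "z j \<notin> T e" if "j < card W" "e \<in> I" for j e using zW that by (auto simp: W_def)
  have w_eq: "w (h i) k = w (h i') k' \<longleftrightarrow> i = i' \<and> k = k'"
    if "i < card I" "i' < card I" "k < 3" "k' < 3" for i i' k k'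
  proof
    assume eq: "w (h i) k = w (h i') k'"
    have "h i = h i'" using disj[OF hI hI] wT[of i k] wT[of i' k'] eq that by metis
    then have "i = i'" using h_eq that by blast
    moreover have "k = k'"
      using w[OF hI[OF that(1)]] eq that \<open>i = i'\<close> by (auto simp: bij_betw_def inj_on_def)
    ultimately show "i = i' \<and> k = k'" by blast
  qed simp
  have z_eq: "z j = z j' \<longleftrightarrow> j = j'" if "j < card W" "j' < card W" for j j'
    using z that by (auto simp: bij_betw_def inj_on_def)
  have wz: "w (h i) k \<noteq> z j" "z j \<noteq> w (h i) k" if "i < card I" "k < 3" "j < card W" for i j k
    using wT zT hI that by metis+
  have bij: "bij_betw \<phi> (pverts ?H) (pverts G)"
  proof (rule bij_betw_imageI)
    show "inj_on \<phi> (pverts ?H)"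
      unfolding pverts_triangles by (rule inj_onI) (auto simp: \<phi> w_eq z_eq wz)
    show "\<phi> ` pverts ?H = pverts G"
    proof
      have "w (h i) k \<in> pverts G" if "i < card I" "k < 3" for i k
        using wT[OF that] sub[OF hI[OF that(1)]] by blast
      moreover have "z j \<in> pverts G" if "j < card W" for j using zW[OF that] by (simp add: W_def)
      ultimately show "\<phi> ` pverts ?H \<subseteq> pverts G"
        unfolding pverts_triangles by (auto simp: \<phi>)
      show "pverts G \<subseteq> \<phi> ` pverts ?H"
      proof
        fix v assume v: "v \<in> pverts G"
        show "v \<in> \<phi> ` pverts ?H"
        proof (cases "v \<in> W")
          case True
          then obtain j where "j < card W" "v = z j" using z by (auto simp: bij_betw_def)
          then have "v = \<phi> (Inr (j, 0))" "Inr (j, 0) \<in> pverts ?H"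
            unfolding pverts_triangles by (auto simp: \<phi>)
          then show ?thesis by blast
        next
          case False
          with v obtain e where e: "e \<in> I" "v \<in> T e" by (auto simp: W_def)
          then obtain i where i: "i < card I" "e = h i" using h by (auto simp: bij_betw_def)
          from e w obtain k where "k < 3" "v = w e k"
            unfolding bij_betw_def by (metis imageE lessThan_iff)
          with i have "v = \<phi> (Inl (i, k))" "Inl (i, k) \<in> pverts ?H"
            unfolding pverts_triangles by (auto simp: \<phi>)
          then show ?thesis by blast
        qed
      qed
    qed
  qed
  have w_T: "w (h i) k \<in> T e \<longleftrightarrow> e = h i" if "i < card I" "k < 3" "e \<in> I" for i k e
    using disj[OF \<open>e \<in> I\<close> hI] wT that by blast
  have pres: "(p, q) \<in> parcs ?H \<longleftrightarrow> (\<phi> p, \<phi> q) \<in> parcs G"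
    if p: "p \<in> pverts ?H" and q: "q \<in> pverts ?H" for p q
    using p q unfolding pverts_triangles parcs_triangles arc
    by (auto simp: \<phi> w_eq z_eq wz w_T h_eq hI zT)
  \<comment> \<open>The isomorphism criterion asks for a map out of \<open>G\<close>, hence the
    inverse.\<close>
  have "bij_betw (inv_into (pverts ?H) \<phi>) (pverts G) (pverts ?H)"
    using bij by (rule bij_betw_inv_into)
  moreover have "(u, v) \<in> parcs G \<longleftrightarrow>
      (inv_into (pverts ?H) \<phi> u, inv_into (pverts ?H) \<phi> v) \<in> parcs ?H"
    if "u \<in> pverts G" "v \<in> pverts G" for u v
  proof -
    have "inv_into (pverts ?H) \<phi> u \<in> pverts ?H" "inv_into (pverts ?H) \<phi> v \<in> pverts ?H"
      using bij that by (simp_all add: bij_betw_def inv_into_into)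
    then show ?thesis
      using pres bij that by (simp add: bij_betw_inv_into_right)
  qed
  ultimately have "digraph_iso (with_proj G) (with_proj ?H)"
    using digraph_iso_pair_iff[OF pair_wf_digraph_axioms pair_wf_digraph_triangles] by blast
  then show ?thesis by blast
qed

text \<open>Choosing one vertex from each triangle and keeping all isolated vertices yields
  \<open>3 ^ t\<close> different maximal independent sets.\<close>

lemma (in pair_graph) mis_ge_triangles:
  assumes "digraph_iso (with_proj G)
    (with_proj (disjoint_union (copies t (complete_graph 3)) (copies r (complete_graph 1))))"
  shows "3 ^ t \<le> mis G"
proof -
  let ?H = "disjoint_union (copies t (complete_graph 3)) (copies r (complete_graph 1))"
  obtain f where f: "bij_betw f (pverts G) (pverts ?H)"
    and arc': "\<forall>u\<in>pverts G. \<forall>v\<in>pverts G. (u, v) \<in> parcs G \<longleftrightarrow> (f u, f v) \<in> parcs ?H"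
    using assms digraph_iso_pair_iff[OF pair_wf_digraph_axioms pair_wf_digraph_triangles] by blast
  have arc: "(u, v) \<in> parcs G \<longleftrightarrow>
      (\<exists>i k l. f u = Inl (i, k) \<and> f v = Inl (i, l) \<and> i < t \<and> k < 3 \<and> l < 3 \<and> k \<noteq> l)"
    if "u \<in> pverts G" "v \<in> pverts G" for u v
    using arc' that unfolding parcs_triangles by simp
  \<comment> \<open>\<open>c i\<close> is the vertex chosen in triangle \<open>i\<close>;
    extensionality lets \<open>c\<close> be recovered from its values below
    \<open>t\<close>.\<close>
  define C where "C = ({..<t} \<rightarrow>\<^sub>E {..<3::nat})"
  \<comment> \<open>Excluding the unchosen triangle vertices, rather than listing the chosen ones,
    retains every isolated vertex.\<close>
  define S where "S c = {v \<in> pverts G. f v \<notin> {Inl (i, k) | i k. k \<noteq> c i}}" for c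
  have obtain_vertex: "\<exists>v\<in>S c. f v = Inl (i, c i)" if "c \<in> C" "i < t" for c i
  proof -
    have "Inl (i, c i) \<in> pverts ?H"
      using that unfolding pverts_triangles by (auto simp: C_def)
    then have "Inl (i, c i) \<in> f ` pverts G" using f by (simp add: bij_betw_def)
    then obtain v where "v \<in> pverts G" "f v = Inl (i, c i)" by (metis imageE)
    then show ?thesis by (auto simp: S_def)
  qed
  have "maximal_independent_set G (S c)" if c: "c \<in> C" for c
    unfolding maximal_independent_set_iff[OF pair_graph_axioms]
  proof
    \<comment> \<open>An arc joins labels \<open>(i, k)\<close> and \<open>(i, l)\<close> with
      \<open>k\<close> and \<open>l\<close> distinct, but membership in \<open>S c\<close> forces
      both to be \<open>c i\<close>.\<close>
    show "independent_set G (S c)"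
      unfolding independent_set_def by (auto simp: S_def arc)
    show "\<forall>v\<in>pverts G - S c. \<exists>u\<in>S c. (u, v) \<in> parcs G"
    proof
      fix v assume v: "v \<in> pverts G - S c"
      then obtain i k where ik: "f v = Inl (i, k)" "k \<noteq> c i" by (auto simp: S_def)
      moreover have "f v \<in> pverts ?H" using f v by (auto simp: bij_betw_def)
      ultimately have lt: "i < t" "k < 3" unfolding pverts_triangles by auto
      with obtain_vertex c obtain u where u: "u \<in> S c" "f u = Inl (i, c i)" by blast
      have "c i < 3" using c lt by (auto simp: C_def)
      with u v ik lt have "(u, v) \<in> parcs G" by (auto simp: S_def arc)
      with u show "\<exists>u\<in>S c. (u, v) \<in> parcs G" by blast
    qed
  qed
  then have "S ` C \<subseteq> {S. maximal_independent_set G S}" by blast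
  moreover have "inj_on S C"
  proof (rule inj_onI)
    fix c d assume c: "c \<in> C" and d: "d \<in> C" and eq: "S c = S d"
    show "c = d"
    proof (rule PiE_ext)
      show "c i = d i" if "i \<in> {..<t}" for i
      proof -
        from that c obtain v where v: "v \<in> S c" "f v = Inl (i, c i)"
          using obtain_vertex by blast
        \<comment> \<open>\<open>v\<close> carries the label \<open>c i\<close>, and membership in
          \<open>S d\<close> forces that label to be \<open>d i\<close>.\<close>
        then have "v \<in> S d" using eq by simp
        then show ?thesis using v by (auto simp: S_def)
      qed
    qed (use c d in \<open>simp_all add: C_def\<close>)
  qed
  ultimately have "card C \<le> mis G"
    unfolding mis_def using mis_finite by (intro card_inj_on_le)
  then show ?thesis by (simp add: C_def card_PiE)
qed

theorem theorem1:
  fixes G :: "'a pair_pre_digraph" and t :: nat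
  assumes "pair_graph G"
    and "matching_number G = t"
  shows "mis G \<le> 3 ^ t \<and>
    (mis G = 3 ^ t \<longleftrightarrow>
      (\<exists>r::nat. digraph_iso (with_proj G)
        (with_proj (disjoint_union (copies t (complete_graph 3)) (copies r (complete_graph 1))))))"
proof -
  interpret pair_graph G by fact
  obtain M where M: "matching G M" "card M = matching_number G"
    by (rule obtain_maximum_matching)
  interpret maximum_matching G M by unfold_locales fact+
  have t: "card M = t" using M assms by simp
  have "\<exists>r. digraph_iso (with_proj G)
      (with_proj (disjoint_union (copies t (complete_graph 3)) (copies r (complete_graph 1))))"
    if "mis G = 3 ^ t"
  proof -
    interpret extremal_matching G M using that t by unfold_locales simp
    show ?thesis
      using digraph_iso_triangles[OF assms(1) finite_M card_triangle triangle_subset_verts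
          triangle_disjoint arc_iff_triangle] t by simp
  qed
  \<comment> \<open>For the converse, \<open>mis_ge_triangles\<close> meets the general bound
    \<open>mis_le\<close>.\<close>
  then show ?thesis using mis_le t mis_ge_triangles by (meson le_antisym)
qed

end
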